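(* Let $A$ and $B$ be rings. Then $A$ and $B$ are both TAF-rings if and only if their direct product $A\times B$ is a TAF-ring.
   Context: All rings are commutative with identity. An ideal $I$ of a ring $R$ is a 2-absorbing ideal (TA-ideal) if whenever $a,b,c\in R$ and $abc\in I$, then $ab\in I$ or $ac\in I$ or $bc\in I$. A TA-factorization of an ideal $I$ is an expression $I=J_1\cdots J_n$ as a product of proper TA-ideals. $R$ is a TAF-ring if every proper ideal of $R$ has a TA-factorization. *)

theory Defs
  imports "HOL-Algebra.Ideal_Product" "HOL-Algebra.Chinese_Remainder"
begin

(* Not required to be proper: carrier R is trivially a TA-ideal. *)
locale ta_ideal = ideal +
  assumes two_absorbing:
    "\<lbrakk>a \<in> carrier R; b \<in> carrier R; c \<in> carrier R; a \<otimes> b \<otimes> c \<in> I\<rbrakk>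
      \<Longrightarrow> a \<otimes> b \<in> I \<or> a \<otimes> c \<in> I \<or> b \<otimes> c \<in> I"

(* The final carrier R in the fold is the unit for multiplication of ideals. *)
definition ta_factorization :: "('a, 'b) ring_scheme \<Rightarrow> 'a set list \<Rightarrow> 'a set \<Rightarrow> bool" where
  "ta_factorization R Js I \<longleftrightarrow>
     Js \<noteq> [] \<and>
     (\<forall>J \<in> set Js. ta_ideal J R \<and> J \<noteq> carrier R) \<and>
     I = foldr (ideal_prod R) Js (carrier R)"

(* The zero ring has no proper ideal, so it is a TAF-ring. *)
locale taf_ring = cring +
  assumes ex_ta_factorization:
    "\<lbrakk>ideal I R; I \<noteq> carrier R\<rbrakk> \<Longrightarrow> \<exists>Js. ta_factorization R Js I"

end

(* An ideal of A x B is a product I x J of ideals, and products of ideals are computed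
   componentwise. Improper factors may be dropped from or added to a factorization, so a ring is
   TAF iff each ideal is a finite, possibly empty, product of possibly improper TA-ideals. In this
   form the TAF-property transfers directly: the components of a TA-ideal of A x B are TA-ideals,
   while I x B and A x J are TA-ideals whenever I and J are. *)

theory Submission
  imports Defs
begin

section \<open>Ideals of a direct product and products of such ideals\<close>

lemma RDirProd_simps:
  "carrier (RDirProd A B) = carrier A \<times> carrier B"
  "(a, b) \<otimes>\<^bsub>RDirProd A B\<^esub> (a', b') = (a \<otimes>\<^bsub>A\<^esub> a', b \<otimes>\<^bsub>B\<^esub> b')"
  "(a, b) \<oplus>\<^bsub>RDirProd A B\<^esub> (a', b') = (a \<oplus>\<^bsub>A\<^esub> a', b \<oplus>\<^bsub>B\<^esub> b')"
  "\<one>\<^bsub>RDirProd A B\<^esub> = (\<one>\<^bsub>A\<^esub>, \<one>\<^bsub>B\<^esub>)"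
  "\<zero>\<^bsub>RDirProd A B\<^esub> = (\<zero>\<^bsub>A\<^esub>, \<zero>\<^bsub>B\<^esub>)"
  by (auto simp: RDirProd_def DirProd_def monoid.defs)

lemma RDirProd_cring:
  assumes "cring A" "cring B"
  shows "cring (RDirProd A B)"
proof -
  interpret A: cring A by fact
  interpret B: cring B by fact
  interpret ring "RDirProd A B"
    by (rule RDirProd_ring) unfold_locales
  show ?thesis
    by unfold_locales (auto simp: RDirProd_simps A.m_comm B.m_comm)
qed

lemma ideal_RDirProd:
  assumes "ideal I A" "ideal J B"
  shows "ideal (I \<times> J) (RDirProd A B)"
proof -
  interpret I: ideal I A by fact
  interpret J: ideal J B by fact
  have "subgroup (I \<times> J) (add_monoid (RDirProd A B))"
    unfolding RDirProd_add_monoid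
    by (rule DirProd_subgroups)
      (auto intro: I.a_subgroup J.a_subgroup I.add.is_group J.add.is_group)
  then show ?thesis
    by (intro idealI RDirProd_ring I.ring_axioms J.ring_axioms)
      (auto simp: RDirProd_simps I.I_l_closed I.I_r_closed J.I_l_closed J.I_r_closed)
qed

lemma (in ring) ideal_foldr_ideal_prod:
  assumes "\<forall>J\<in>set Js. ideal J R"
  shows "ideal (foldr (ideal_prod R) Js (carrier R)) R"
  using assms by (induct Js) (auto intro: ideal_prod_is_ideal oneideal)

context
  fixes A :: "('a, 'm) ring_scheme" and B :: "('b, 'n) ring_scheme"
  assumes rings: "ring A" "ring B"
begin

interpretation A: ring A by (fact rings)
interpretation B: ring B by (fact rings)

text \<open>Multiplication by the idempotents (1,0) and (0,1) shows that \<open>K\<close> contains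
  (a,0) and (0,b) along with (a,b). Sums of such elements combine the first coordinate of one
  element of \<open>K\<close> with the second coordinate of another, so \<open>K\<close> fills the
  whole product of its projections.\<close>

lemma ideal_RDirProd_decomp:
  assumes "ideal K (RDirProd A B)"
  shows "ideal (fst ` K) A" "ideal (snd ` K) B" "K = fst ` K \<times> snd ` K"
proof -
  interpret K: ideal K "RDirProd A B" by fact
  have carr: "a \<in> carrier A" "b \<in> carrier B" if "(a, b) \<in> K" for a b
    using K.Icarr[OF that] by (auto simp: RDirProd_simps)
  \<comment> \<open>Both sides are recorded because \<open>A\<close> and \<open>B\<close> are only
    assumed to be rings in this context, not commutative ones.\<close>
  have mult: "(a \<otimes>\<^bsub>A\<^esub> x, b \<otimes>\<^bsub>B\<^esub> y) \<in> K" "(x \<otimes>\<^bsub>A\<^esub> a, y \<otimes>\<^bsub>B\<^esub> b) \<in> K"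
    if "(a, b) \<in> K" "x \<in> carrier A" "y \<in> carrier B" for a b x y
    using K.I_r_closed[OF that(1), of "(x, y)"] K.I_l_closed[OF that(1), of "(x, y)"] that(2,3)
    by (auto simp: RDirProd_simps)
  have left: "(a, \<zero>\<^bsub>B\<^esub>) \<in> K" and right: "(\<zero>\<^bsub>A\<^esub>, b) \<in> K" if "(a, b) \<in> K" for a b
    using mult(1)[OF that, of "\<one>\<^bsub>A\<^esub>" "\<zero>\<^bsub>B\<^esub>"] mult(1)[OF that, of "\<zero>\<^bsub>A\<^esub>" "\<one>\<^bsub>B\<^esub>"] carr[OF that]
    by auto
  have add: "(a \<oplus>\<^bsub>A\<^esub> a', b \<oplus>\<^bsub>B\<^esub> b') \<in> K" if "(a, b) \<in> K" "(a', b') \<in> K" for a b a' b'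
    using additive_subgroup.a_closed[OF K.additive_subgroup_axioms that] by (simp add: RDirProd_simps)
  have zero: "(\<zero>\<^bsub>A\<^esub>, \<zero>\<^bsub>B\<^esub>) \<in> K"
    using additive_subgroup.zero_closed[OF K.additive_subgroup_axioms] by (simp add: RDirProd_simps)
  \<comment> \<open>Negation is multiplication by the pair (-1,-1), so it is a case of
    \<open>mult\<close>.\<close>
  have uminus: "(\<ominus>\<^bsub>A\<^esub> a, \<ominus>\<^bsub>B\<^esub> b) \<in> K" if "(a, b) \<in> K" for a b
    using mult(2)[OF that, of "\<ominus>\<^bsub>A\<^esub> \<one>\<^bsub>A\<^esub>" "\<ominus>\<^bsub>B\<^esub> \<one>\<^bsub>B\<^esub>"] carr[OF that]
    by (simp add: A.l_minus B.l_minus)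
  have fst_iff: "x \<in> fst ` K \<longleftrightarrow> (\<exists>y. (x, y) \<in> K)"
    and snd_iff: "y \<in> snd ` K \<longleftrightarrow> (\<exists>x. (x, y) \<in> K)" for x y
    by force+
  show "ideal (fst ` K) A"
  proof (rule idealI[OF rings(1)])
    show "subgroup (fst ` K) (add_monoid A)"
    proof (rule A.add.subgroupI)
      show "fst ` K \<subseteq> carrier A" using carr by auto
      show "fst ` K \<noteq> {}" using zero by auto
      show "\<ominus>\<^bsub>A\<^esub> x \<in> fst ` K" if "x \<in> fst ` K" for x
        using that uminus unfolding fst_iff by blast
      show "x \<oplus>\<^bsub>A\<^esub> y \<in> fst ` K" if "x \<in> fst ` K" "y \<in> fst ` K" for x y
        using that add unfolding fst_iff by blast
    qed
    \<comment> \<open>\<open>mult\<close> asks for a multiplier in the other coordinate as well;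
      zero is an element of that carrier which always exists.\<close>
    show "x \<otimes>\<^bsub>A\<^esub> a \<in> fst ` K" "a \<otimes>\<^bsub>A\<^esub> x \<in> fst ` K" if "a \<in> fst ` K" "x \<in> carrier A" for a x
      using that mult A.zero_closed B.zero_closed unfolding fst_iff by blast+
  qed
  show "ideal (snd ` K) B"
  proof (rule idealI[OF rings(2)])
    show "subgroup (snd ` K) (add_monoid B)"
    proof (rule B.add.subgroupI)
      show "snd ` K \<subseteq> carrier B" using carr by auto
      show "snd ` K \<noteq> {}" using zero by auto
      show "\<ominus>\<^bsub>B\<^esub> x \<in> snd ` K" if "x \<in> snd ` K" for x
        using that uminus unfolding snd_iff by blast
      show "x \<oplus>\<^bsub>B\<^esub> y \<in> snd ` K" if "x \<in> snd ` K" "y \<in> snd ` K" for x y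
        using that add unfolding snd_iff by blast
    qed
    show "x \<otimes>\<^bsub>B\<^esub> a \<in> snd ` K" "a \<otimes>\<^bsub>B\<^esub> x \<in> snd ` K" if "a \<in> snd ` K" "x \<in> carrier B" for a x
      using that mult A.zero_closed B.zero_closed unfolding snd_iff by blast+
  qed
  have "(a, b) \<in> K" if "(a, b') \<in> K" "(a', b) \<in> K" for a b a' b'
    using add[OF left[OF that(1)] right[OF that(2)]] carr[OF that(1)] carr[OF that(2)] by simp
  then show "K = fst ` K \<times> snd ` K"
    by force
qed

text \<open>From left to right, induction over the generation of the product ideal works
  coordinatewise. Conversely, (i,0)(j,0) = (ij,0) with zero in every ideal, so the left side
  contains (x,0) and, likewise, (0,y) for all x and y in the component products; hence it contains
  their sum (x,y).\<close>

lemma ideal_prod_RDirProd: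
  assumes I: "ideal I A" "ideal I' A" and J: "ideal J B" "ideal J' B"
  shows "(I \<times> J) \<cdot>\<^bsub>RDirProd A B\<^esub> (I' \<times> J') = (I \<cdot>\<^bsub>A\<^esub> I') \<times> (J \<cdot>\<^bsub>B\<^esub> J')"
    (is "?L = _")
proof (intro equalityI subsetI)
  fix x assume "x \<in> ?L"
  then show "x \<in> (I \<cdot>\<^bsub>A\<^esub> I') \<times> (J \<cdot>\<^bsub>B\<^esub> J')"
    by induct (auto simp: RDirProd_simps intro: ideal_prod.intros)
next
  interpret I: ideal I A by fact
  interpret I': ideal I' A by fact
  interpret J: ideal J B by fact
  interpret J': ideal J' B by fact
  note zero_closed = I[THEN ideal.axioms(1), THEN additive_subgroup.zero_closed]
    J[THEN ideal.axioms(1), THEN additive_subgroup.zero_closed]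
  have add: "(a \<oplus>\<^bsub>A\<^esub> a', b \<oplus>\<^bsub>B\<^esub> b') \<in> ?L" if "(a, b) \<in> ?L" "(a', b') \<in> ?L" for a b a' b'
    using ideal_prod.sum[OF that] by (simp add: RDirProd_simps)
  have left: "(x, \<zero>\<^bsub>B\<^esub>) \<in> ?L" if "x \<in> I \<cdot>\<^bsub>A\<^esub> I'" for x
    using that
  proof induct
    case (prod i j)
    then show ?case
      using ideal_prod.prod[of "(i, \<zero>\<^bsub>B\<^esub>)" "I \<times> J" "(j, \<zero>\<^bsub>B\<^esub>)" "I' \<times> J'" "RDirProd A B"]
      by (simp add: RDirProd_simps zero_closed)
  next
    case (sum s t)
    then show ?case using add[of s "\<zero>\<^bsub>B\<^esub>" t "\<zero>\<^bsub>B\<^esub>"] by simp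
  qed
  have right: "(\<zero>\<^bsub>A\<^esub>, y) \<in> ?L" if "y \<in> J \<cdot>\<^bsub>B\<^esub> J'" for y
    using that
  proof induct
    case (prod i j)
    then show ?case
      using ideal_prod.prod[of "(\<zero>\<^bsub>A\<^esub>, i)" "I \<times> J" "(\<zero>\<^bsub>A\<^esub>, j)" "I' \<times> J'" "RDirProd A B"]
      by (simp add: RDirProd_simps zero_closed)
  next
    case (sum s t)
    then show ?case using add[of "\<zero>\<^bsub>A\<^esub>" s "\<zero>\<^bsub>A\<^esub>" t] by simp
  qed
  fix z assume "z \<in> (I \<cdot>\<^bsub>A\<^esub> I') \<times> (J \<cdot>\<^bsub>B\<^esub> J')"
  then obtain x y where z: "z = (x, y)" and xy: "x \<in> I \<cdot>\<^bsub>A\<^esub> I'" "y \<in> J \<cdot>\<^bsub>B\<^esub> J'"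
    by auto
  moreover have "x \<in> carrier A" "y \<in> carrier B"
    using xy A.ideal_prod_in_carrier[OF I] B.ideal_prod_in_carrier[OF J] by auto
  ultimately show "z \<in> ?L"
    using add[OF left right, of x y] by simp
qed

text \<open>A list of pairs forces the two component factorizations to have the same length, so that
  they can be matched factor by factor with one in the direct product.\<close>

lemma foldr_ideal_prod_RDirProd:
  assumes "\<forall>(I, J) \<in> set Ps. ideal I A \<and> ideal J B"
  shows "foldr (ideal_prod (RDirProd A B)) (map (\<lambda>(I, J). I \<times> J) Ps) (carrier (RDirProd A B))
    = foldr (ideal_prod A) (map fst Ps) (carrier A) \<times> foldr (ideal_prod B) (map snd Ps) (carrier B)"
  using assms
proof (induct Ps)
  case Nil
  then show ?case by (simp add: RDirProd_simps)
next
  case (Cons P Ps)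
  then have "ideal (foldr (ideal_prod A) (map fst Ps) (carrier A)) A"
    "ideal (foldr (ideal_prod B) (map snd Ps) (carrier B)) B"
    by (force intro!: A.ideal_foldr_ideal_prod B.ideal_foldr_ideal_prod)+
  with Cons show ?case
    by (cases P) (simp add: ideal_prod_RDirProd)
qed

section \<open>TA-ideals of a direct product\<close>

text \<open>Three elements of one component are padded with zero in the other. Since zero lies in
  the other projection of \<open>K\<close>, membership of the padded products in \<open>K\<close> is
  decided by the original coordinate alone.\<close>

lemma ta_ideal_RDirProd_decomp:
  assumes "ta_ideal K (RDirProd A B)"
  shows "ta_ideal (fst ` K) A" "ta_ideal (snd ` K) B"
proof -
  interpret K: ta_ideal K "RDirProd A B" by fact
  note dec = ideal_RDirProd_decomp[OF K.ideal_axioms]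
  interpret I: ideal "fst ` K" A by (fact dec)
  interpret J: ideal "snd ` K" B by (fact dec)
  have mem: "(x, y) \<in> K \<longleftrightarrow> x \<in> fst ` K \<and> y \<in> snd ` K" for x y
    using dec(3) by (metis mem_Times_iff fst_conv snd_conv)
  show "ta_ideal (fst ` K) A"
  proof
    fix a b c assume "a \<in> carrier A" "b \<in> carrier A" "c \<in> carrier A" "a \<otimes>\<^bsub>A\<^esub> b \<otimes>\<^bsub>A\<^esub> c \<in> fst ` K"
    then show "a \<otimes>\<^bsub>A\<^esub> b \<in> fst ` K \<or> a \<otimes>\<^bsub>A\<^esub> c \<in> fst ` K \<or> b \<otimes>\<^bsub>A\<^esub> c \<in> fst ` K"
      using K.two_absorbing[of "(a, \<zero>\<^bsub>B\<^esub>)" "(b, \<zero>\<^bsub>B\<^esub>)" "(c, \<zero>\<^bsub>B\<^esub>)"]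
      by (simp add: RDirProd_simps mem)
  qed
  show "ta_ideal (snd ` K) B"
  proof
    fix a b c assume "a \<in> carrier B" "b \<in> carrier B" "c \<in> carrier B" "a \<otimes>\<^bsub>B\<^esub> b \<otimes>\<^bsub>B\<^esub> c \<in> snd ` K"
    then show "a \<otimes>\<^bsub>B\<^esub> b \<in> snd ` K \<or> a \<otimes>\<^bsub>B\<^esub> c \<in> snd ` K \<or> b \<otimes>\<^bsub>B\<^esub> c \<in> snd ` K"
      using K.two_absorbing[of "(\<zero>\<^bsub>A\<^esub>, a)" "(\<zero>\<^bsub>A\<^esub>, b)" "(\<zero>\<^bsub>A\<^esub>, c)"]
      by (simp add: RDirProd_simps mem)
  qed
qed

text \<open>Only the first coordinate decides membership, so the condition reduces to the one for
  \<open>I\<close>. The full carrier matters: a product of two proper TA-ideals can fail to be a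
  TA-ideal, as 4Z x 4Z in Z x Z does for (2,2), (2,1), (1,2).\<close>

lemma ta_ideal_Times_carrier:
  assumes "ta_ideal I A"
  shows "ta_ideal (I \<times> carrier B) (RDirProd A B)"
proof -
  interpret I: ta_ideal I A by fact
  interpret K: ideal "I \<times> carrier B" "RDirProd A B"
    by (intro ideal_RDirProd I.ideal_axioms B.oneideal)
  show ?thesis
  proof
    fix p q r
    let ?K = "I \<times> carrier B"
    assume "p \<in> carrier (RDirProd A B)" "q \<in> carrier (RDirProd A B)" "r \<in> carrier (RDirProd A B)"
      "p \<otimes>\<^bsub>RDirProd A B\<^esub> q \<otimes>\<^bsub>RDirProd A B\<^esub> r \<in> ?K"
    then show "p \<otimes>\<^bsub>RDirProd A B\<^esub> q \<in> ?K \<or> p \<otimes>\<^bsub>RDirProd A B\<^esub> r \<in> ?K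
      \<or> q \<otimes>\<^bsub>RDirProd A B\<^esub> r \<in> ?K"
      using I.two_absorbing[of "fst p" "fst q" "fst r"]
      by (cases p; cases q; cases r) (auto simp: RDirProd_simps)
  qed
qed

lemma ta_ideal_carrier_Times:
  assumes "ta_ideal J B"
  shows "ta_ideal (carrier A \<times> J) (RDirProd A B)"
proof -
  interpret J: ta_ideal J B by fact
  interpret K: ideal "carrier A \<times> J" "RDirProd A B"
    by (intro ideal_RDirProd J.ideal_axioms A.oneideal)
  show ?thesis
  proof
    fix p q r
    let ?K = "carrier A \<times> J"
    assume "p \<in> carrier (RDirProd A B)" "q \<in> carrier (RDirProd A B)" "r \<in> carrier (RDirProd A B)"
      "p \<otimes>\<^bsub>RDirProd A B\<^esub> q \<otimes>\<^bsub>RDirProd A B\<^esub> r \<in> ?K"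
    then show "p \<otimes>\<^bsub>RDirProd A B\<^esub> q \<in> ?K \<or> p \<otimes>\<^bsub>RDirProd A B\<^esub> r \<in> ?K
      \<or> q \<otimes>\<^bsub>RDirProd A B\<^esub> r \<in> ?K"
      using J.two_absorbing[of "snd p" "snd q" "snd r"]
      by (cases p; cases q; cases r) (auto simp: RDirProd_simps)
  qed
qed

end

section \<open>Improper factors and a reformulation of the TAF-property\<close>

lemma (in cring) foldr_ideal_prod_filter_proper:
  assumes "\<forall>J\<in>set Js. ideal J R"
  shows "foldr (ideal_prod R) (filter (\<lambda>J. J \<noteq> carrier R) Js) (carrier R)
    = foldr (ideal_prod R) Js (carrier R)"
  using assms
proof (induct Js)
  case (Cons J Js)
  \<comment> \<open>A dropped factor stands on the left of the remaining product; commutativity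
    together with the unit law for \<open>carrier R\<close> removes it.\<close>
  then have "carrier R \<cdot> foldr (ideal_prod R) Js (carrier R) = foldr (ideal_prod R) Js (carrier R)"
    by (metis ideal_foldr_ideal_prod ideal_prod_commute ideal_prod_one list.set_intros(2) oneideal)
  with Cons show ?case by simp
qed simp

text \<open>Both lists have the same proper factors, hence the same product. This removes the
  padding that arises when factorizations of the two components are joined into one list of
  pairs.\<close>

lemma (in cring) foldr_ideal_prod_carriers:
  assumes "\<forall>J\<in>set Js. ideal J R" "set Cs \<subseteq> {carrier R}" "set Ds \<subseteq> {carrier R}"
  shows "foldr (ideal_prod R) (Cs @ Js @ Ds) (carrier R) = foldr (ideal_prod R) Js (carrier R)"
proof -
  have "filter (\<lambda>J. J \<noteq> carrier R) (Cs @ Js @ Ds) = filter (\<lambda>J. J \<noteq> carrier R) Js"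
  proof -
    have "\<forall>C\<in>set Cs. C = carrier R" "\<forall>D\<in>set Ds. D = carrier R"
      using assms(2,3) by blast+
    then show ?thesis by simp
  qed
  moreover have "\<forall>J\<in>set (Cs @ Js @ Ds). ideal J R"
    using assms oneideal by auto
  ultimately show ?thesis
    using assms(1) foldr_ideal_prod_filter_proper by metis
qed

text \<open>Allowing improper ideals and factors avoids case distinctions later: a proper ideal of a
  direct product can have an improper projection, and so can a proper factor.\<close>

lemma (in cring) taf_ring_iff:
  "taf_ring R \<longleftrightarrow> (\<forall>I. ideal I R \<longrightarrow>
     (\<exists>Js. (\<forall>J\<in>set Js. ta_ideal J R) \<and> I = foldr (ideal_prod R) Js (carrier R)))"
    (is "_ \<longleftrightarrow> (\<forall>I. _ \<longrightarrow> ?P I)")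
proof (intro iffI allI impI)
  fix I assume "taf_ring R" "ideal I R"
  then show "?P I"
    using taf_ring.ex_ta_factorization[of R I]
    \<comment> \<open>The improper ideal is the empty product.\<close>
    by (cases "I = carrier R") (auto simp: ta_factorization_def intro: exI[of _ "[]"])
next
  assume fact: "\<forall>I. ideal I R \<longrightarrow> ?P I"
  show "taf_ring R"
  proof
    fix I assume "ideal I R" and proper: "I \<noteq> carrier R"
    then obtain Js where Js: "\<forall>J\<in>set Js. ta_ideal J R" "I = foldr (ideal_prod R) Js (carrier R)"
      using fact by blast
    define Js' where "Js' = filter (\<lambda>J. J \<noteq> carrier R) Js"
    have I: "I = foldr (ideal_prod R) Js' (carrier R)"
      using Js foldr_ideal_prod_filter_proper[of Js] by (auto simp: Js'_def ta_ideal_def)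
    \<comment> \<open>The empty product is \<open>carrier R\<close>, so a proper \<open>I\<close>
      leaves at least one factor after filtering.\<close>
    with proper have "Js' \<noteq> []" by auto
    with I Js(1) have "ta_factorization R Js' I"
      by (auto simp: ta_factorization_def Js'_def)
    then show "\<exists>Js. ta_factorization R Js I" ..
  qed
qed

section \<open>Transfer of factorizations between a direct product and its components\<close>

theorem proposition2p4:
  fixes A :: "('a, 'm) ring_scheme" and B :: "('b, 'n) ring_scheme"
  assumes "cring A" and "cring B"
  shows "taf_ring A \<and> taf_ring B \<longleftrightarrow> taf_ring (RDirProd A B)"
proof -
  let ?R = "RDirProd A B"
  interpret A: cring A by fact
  interpret B: cring B by fact
  interpret R: cring ?R using assms by (rule RDirProd_cring)
  note rings = A.ring_axioms B.ring_axioms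
  show ?thesis
  proof (intro iffI conjI)
    assume taf: "taf_ring A \<and> taf_ring B"
    show "taf_ring ?R"
      unfolding R.taf_ring_iff
    proof (intro allI impI)
      fix K assume "ideal K ?R"
      note dec = ideal_RDirProd_decomp[OF rings this]
      obtain Is where Is: "\<forall>I\<in>set Is. ta_ideal I A" "fst ` K = foldr (ideal_prod A) Is (carrier A)"
        using taf dec(1) A.taf_ring_iff by blast
      obtain Js where Js: "\<forall>J\<in>set Js. ta_ideal J B" "snd ` K = foldr (ideal_prod B) Js (carrier B)"
        using taf dec(2) B.taf_ring_iff by blast
      \<comment> \<open>Each TA-factor of one projection is paired with the full carrier of the
        other ring, which makes every factor of \<open>K\<close> a TA-ideal; in each coordinate the
        added carriers do not change the product.\<close>
      define Ps where "Ps = map (\<lambda>I. (I, carrier B)) Is @ map (\<lambda>J. (carrier A, J)) Js"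
      have "foldr (ideal_prod A) (map fst Ps) (carrier A) = fst ` K"
        using A.foldr_ideal_prod_carriers[of Is "[]" "map (\<lambda>J. carrier A) Js"] Is
        by (auto simp: Ps_def o_def ta_ideal_def)
      moreover have "foldr (ideal_prod B) (map snd Ps) (carrier B) = snd ` K"
        using B.foldr_ideal_prod_carriers[of Js "map (\<lambda>I. carrier B) Is" "[]"] Js
        by (auto simp: Ps_def o_def ta_ideal_def)
      moreover have "\<forall>(I, J) \<in> set Ps. ideal I A \<and> ideal J B"
        using Is(1) Js(1) A.oneideal B.oneideal by (auto simp: Ps_def ta_ideal_def)
      ultimately have
        "K = foldr (ideal_prod ?R) (map (\<lambda>(I, J). I \<times> J) Ps) (carrier ?R)"
        using foldr_ideal_prod_RDirProd[OF rings, of Ps] dec(3) by simp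
      moreover have "\<forall>J\<in>set (map (\<lambda>(I, J). I \<times> J) Ps). ta_ideal J ?R"
        using Is(1) Js(1) ta_ideal_Times_carrier[OF rings] ta_ideal_carrier_Times[OF rings]
        by (auto simp: Ps_def)
      ultimately show "\<exists>Ks. (\<forall>K\<in>set Ks. ta_ideal K ?R) \<and> K = foldr (ideal_prod ?R) Ks (carrier ?R)"
        by blast
    qed
  next
    assume taf: "taf_ring ?R"
    \<comment> \<open>Both components are treated at once: \<open>J = carrier B\<close> later yields
      the claim for \<open>A\<close>, and \<open>I = carrier A\<close> the claim for
      \<open>B\<close>.\<close>
    have ex: "\<exists>Is Js. (\<forall>I\<in>set Is. ta_ideal I A) \<and> (\<forall>J\<in>set Js. ta_ideal J B)
      \<and> I = foldr (ideal_prod A) Is (carrier A) \<and> J = foldr (ideal_prod B) Js (carrier B)"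
      if IJ: "ideal I A" "ideal J B" for I J
    proof -
      obtain Ks where Ks: "\<forall>K\<in>set Ks. ta_ideal K ?R"
        "I \<times> J = foldr (ideal_prod ?R) Ks (carrier ?R)"
        using taf ideal_RDirProd[OF IJ] R.taf_ring_iff by blast
      define Ps where "Ps = map (\<lambda>K. (fst ` K, snd ` K)) Ks"
      have ideal_Ks: "\<forall>K\<in>set Ks. ideal K ?R"
        using Ks(1) by (auto simp: ta_ideal_def)
      then have "map (\<lambda>(I, J). I \<times> J) Ps = Ks"
        using ideal_RDirProd_decomp(3)[OF rings] by (auto simp: Ps_def intro!: map_idI)
      moreover have "\<forall>(I, J) \<in> set Ps. ideal I A \<and> ideal J B"
        using ideal_Ks ideal_RDirProd_decomp(1,2)[OF rings] by (auto simp: Ps_def)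
      ultimately have "I \<times> J = foldr (ideal_prod A) (map fst Ps) (carrier A)
          \<times> foldr (ideal_prod B) (map snd Ps) (carrier B)"
        using foldr_ideal_prod_RDirProd[OF rings, of Ps] Ks(2) by simp
      \<comment> \<open>A Cartesian product determines its factors only if they are nonempty; here
        each ideal contains zero.\<close>
      moreover have "I \<noteq> {}" "J \<noteq> {}"
        using IJ[THEN ideal.axioms(1), THEN additive_subgroup.zero_closed] by auto
      ultimately have "I = foldr (ideal_prod A) (map fst Ps) (carrier A)"
          "J = foldr (ideal_prod B) (map snd Ps) (carrier B)"
        by (auto simp: times_eq_iff)
      moreover have "\<forall>I\<in>set (map fst Ps). ta_ideal I A" "\<forall>J\<in>set (map snd Ps). ta_ideal J B"
        using Ks(1) ta_ideal_RDirProd_decomp[OF rings] by (auto simp: Ps_def)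
      ultimately show ?thesis by blast
    qed
    show "taf_ring A"
      unfolding A.taf_ring_iff using ex[OF _ B.oneideal] by blast
    show "taf_ring B"
      unfolding B.taf_ring_iff using ex[OF A.oneideal] by blast
  qed
qed

end
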